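(* Let $F$ be a finite field and let $n>1$ be an integer. Then the clique number of $\Gamma(M_n(F),[1])$ is $|F|^n$.
   Context: $\Gamma(M_n(F),[1])$ denotes the graph whose vertex set is the ring $M_n(F)$ of $n\times n$ matrices over $F$, with two matrices $X,Y$ adjacent if $\operatorname{rank}(X-Y)=1$. The clique number of a graph is the number of vertices in its largest complete subgraph. *)

theory Defs
  imports "HOL-Analysis.Cartesian_Space" "Graph_Theory.Kuratowski"
begin

text \<open>Undirected graphs are symmetric loop-free digraphs, as in the locale \<^locale>\<open>graph\<close>; each edge is
  represented by its two orientations.\<close>

definition rank_one_graph :: "('a::field^'n^'n) pair_pre_digraph" where
  "rank_one_graph = \<lparr> pverts = UNIV, parcs = {(X, Y). rank (X - Y) = 1} \<rparr>"

text \<open>\<^const>\<open>Max\<close> is only meaningful on finite nonempty sets, so this is the clique number for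
  finite graphs only.\<close>

definition clique_number :: "('v, 'e) pre_digraph \<Rightarrow> nat" where
  "clique_number G =
     Max {card (verts H) | H :: ('v, 'e) pre_digraph. subgraph H G \<and> K\<^bsub>card (verts H)\<^esub> H}"

lemma finite_clique_cards:
  assumes "finite (verts G)"
  shows "finite {card (verts H) | H. subgraph H G \<and> K\<^bsub>card (verts H)\<^esub> H}"
  by (rule finite_subset[of _ "{..card (verts G)}"])
     (auto simp: subgraph_def intro: card_mono[OF assms])

lemma rank_minus_commute:
  fixes X Y :: "'a::field^'n^'m"
  shows "rank (X - Y) = rank (Y - X)"
proof -
  have "rows (A - B) \<subseteq> vec.span (rows (B - A))" for A B :: "'a^'n^'m"
  proof
    fix v assume "v \<in> rows (A - B)"
    then obtain i where "v = - row i (B - A)"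
      by (auto simp: rows_def row_def vec_eq_iff)
    moreover have "row i (B - A) \<in> vec.span (rows (B - A))"
      by (rule vec.span_base) (auto simp: rows_def)
    ultimately show "v \<in> vec.span (rows (B - A))"
      by (simp add: vec.span_neg)
  qed
  then have "vec.span (rows (X - Y)) = vec.span (rows (Y - X))"
    by (simp add: vec.span_eq)
  then show ?thesis
    unfolding row_rank_def_gen by (rule vec.span_eq_dim)
qed

lemma graph_rank_one_graph:
  "graph (with_proj (rank_one_graph :: ('a::{field,finite}^'n^'n) pair_pre_digraph))"
proof -
  have rank_zero: "rank (0 :: 'a^'n^'n) = 0"
    by (auto simp: row_rank_def_gen rows_def row_def vec.dim_eq_0 vec_eq_iff)
  have "pair_graph (rank_one_graph :: ('a^'n^'n) pair_pre_digraph)"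
    by unfold_locales
      (auto simp: rank_one_graph_def symmetric_def sym_def rank_minus_commute rank_zero)
  then interpret pair_graph "rank_one_graph :: ('a^'n^'n) pair_pre_digraph" .
  show ?thesis by unfold_locales
qed

end

theory Submission
  imports Defs
begin

text \<open>Rank-one matrices are the outer products of nonzero vectors. If the difference of two of them
  again has rank one, its \<open>2\<times>2\<close> minors vanish, which forces the two matrices to share their column
  space or their row space. On a translated clique containing \<open>0\<close> this makes the two equivalence
  relations "same column space" and "same row space" jointly exhaust all pairs, so one of them is
  total. Hence the clique embeds into the outer products with one fixed factor, and these outer
  products themselves form a clique.\<close>

section \<open>Outer products and matrices of rank one\<close>

definition outer :: "'a::field^'m \<Rightarrow> 'a^'n \<Rightarrow> 'a^'n^'m" where
  "outer u v = (\<chi> i j. u $ i * v $ j)"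

lemma outer_nth [simp]: "outer u v $ i $ j = u $ i * v $ j"
  by (simp add: outer_def)

lemma outer_diff_right: "outer u (v - w) = outer u v - outer u w"
  by (simp add: vec_eq_iff algebra_simps)

text \<open>The factors of an outer product are determined only up to a scalar; moving it across
  allows one factor to be normalised.\<close>

lemma outer_scale_left: "outer (c *s u) v = outer u (c *s v)"
  by (simp add: vec_eq_iff algebra_simps)

lemma outer_eq_0_iff: "outer u v = 0 \<longleftrightarrow> u = 0 \<or> v = 0"
  by (auto simp: vec_eq_iff)

lemma inj_outer:
  assumes "u \<noteq> 0"
  shows "inj (outer u)"
proof (rule injI)
  fix v w assume "outer u v = outer u w"
  then have "outer u (v - w) = 0"
    by (simp add: outer_diff_right)
  with assms show "v = w"
    by (simp add: outer_eq_0_iff)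
qed

text \<open>All rows are multiples of \<open>v\<close>, and a nonzero coordinate of \<open>u\<close>
  recovers \<open>v\<close> from a row, so the row space is the line through
  \<open>v\<close>.\<close>

lemma rank_outer:
  fixes u :: "'a::field^'m" and v :: "'a^'n"
  assumes "u \<noteq> 0" "v \<noteq> 0"
  shows "rank (outer u v) = 1"
proof -
  have row: "row i (outer u v) = u $ i *s v" for i
    by (simp add: row_def vec_eq_iff)
  obtain i where "u $ i \<noteq> 0"
    using assms(1) by (auto simp: vec_eq_iff)
  then have "v = inverse (u $ i) *s row i (outer u v)"
    by (simp add: row)
  moreover have "row i (outer u v) \<in> rows (outer u v)"
    by (auto simp: rows_def)
  ultimately have "v \<in> vec.span (rows (outer u v))"
    by (metis vec.span_base vec.span_scale)
  moreover have "rows (outer u v) \<subseteq> vec.span {v}"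
    by (auto simp: rows_def row vec.span_singleton)
  ultimately have "vec.span (rows (outer u v)) = vec.span {v}"
    by (simp add: vec.span_eq)
  then have "rank (outer u v) = vec.dim {v}"
    unfolding row_rank_def_gen by (rule vec.span_eq_dim)
  with assms(2) show ?thesis
    by simp
qed

text \<open>A single vector \<open>v\<close> spans the row space; the coefficients of the rows along
  \<open>v\<close> form the column factor.\<close>

lemma rank_one_imp_outer:
  fixes A :: "'a::field^'n^'m"
  assumes "rank A = 1"
  obtains u v where "u \<noteq> 0" "v \<noteq> 0" "A = outer u v"
proof -
  obtain B where B: "rows A \<subseteq> vec.span B" "card B = 1"
    using vec.basis_exists[of "rows A"] assms by (metis row_rank_def_gen)
  then obtain v where "B = {v}"
    by (meson card_1_singletonE)
  then have "\<exists>c. row i A = c *s v" for i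
    using B(1) by (auto simp: rows_def vec.span_singleton)
  then obtain c where "\<And>i. row i A = c i *s v"
    by metis
  then have A: "A = outer (\<chi> i. c i) v"
    by (simp add: vec_eq_iff row_def)
  have "A \<noteq> 0"
  proof
    assume "A = 0"
    then have "rows A \<subseteq> {0}"
      by (auto simp: rows_def row_def vec_eq_iff)
    with assms show False
      by (simp add: row_rank_def_gen flip: vec.dim_eq_0)
  qed
  with A show ?thesis
    by (intro that[of "\<chi> i. c i" v]) (auto simp: outer_eq_0_iff)
qed

section \<open>Differences of outer products\<close>

text \<open>The last hypothesis says that the two-column matrix with columns \<open>u\<close> and
  \<open>x\<close> has no nonzero 2x2 minor. Dividing by a nonzero coordinate of one vector gives
  the factor of proportionality.\<close>

lemma span_eq_of_minors:
  fixes u x :: "'a::field^'n"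
  assumes "u \<noteq> 0" "x \<noteq> 0" "\<And>i k. u $ i * x $ k = u $ k * x $ i"
  shows "vec.span {u} = vec.span {x}"
proof -
  have "a \<in> vec.span {b}"
    if "b \<noteq> 0" and minors: "\<And>i k. a $ i * b $ k = a $ k * b $ i" for a b :: "'a^'n"
  proof -
    obtain k where "b $ k \<noteq> 0"
      using \<open>b \<noteq> 0\<close> by (auto simp: vec_eq_iff)
    then have "a = (a $ k / b $ k) *s b"
      by (simp add: vec_eq_iff field_simps minors)
    then show ?thesis
      by (auto simp: vec.span_singleton)
  qed
  with assms show ?thesis
    by (simp add: vec.span_eq) (metis mult.commute)
qed

lemma outer_diff_eq_outer:
  fixes u x p :: "'a::field^'m" and v y r :: "'a^'n"
  assumes nz: "u \<noteq> 0" "v \<noteq> 0" "x \<noteq> 0" "y \<noteq> 0"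
    and diff: "outer u v - outer x y = outer p r"
  shows "vec.span {u} = vec.span {x} \<or> vec.span {v} = vec.span {y}"
proof -
  have M: "u $ i * v $ j - x $ i * y $ j = p $ i * r $ j" for i j
    using diff by (simp add: vec_eq_iff)
  have "(u $ i * x $ k - u $ k * x $ i) * (v $ j * y $ l - v $ l * y $ j) = 0" for i k j l
  proof -
    \<comment> \<open>The right side is minus the minor of the difference in rows \<open>i\<close>,
      \<open>k\<close> and columns \<open>j\<close>, \<open>l\<close>; the left side is its
      Cauchy-Binet factorization. The minor vanishes because the difference is
      \<open>outer p r\<close>.\<close>
    have "(u $ i * x $ k - u $ k * x $ i) * (v $ j * y $ l - v $ l * y $ j) =
      (u $ i * v $ l - x $ i * y $ l) * (u $ k * v $ j - x $ k * y $ j)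
      - (u $ i * v $ j - x $ i * y $ j) * (u $ k * v $ l - x $ k * y $ l)"
      by (simp add: algebra_simps)
    also have "\<dots> = 0"
      by (simp add: M)
    finally show ?thesis .
  qed
  \<comment> \<open>One factor depends only on \<open>i\<close>, \<open>k\<close> and the other only
    on \<open>j\<close>, \<open>l\<close>, so one of them vanishes identically.\<close>
  then have "(\<forall>i k. u $ i * x $ k = u $ k * x $ i) \<or> (\<forall>j l. v $ j * y $ l = v $ l * y $ j)"
    by (metis mult_eq_0_iff right_minus_eq)
  then show ?thesis
    using nz span_eq_of_minors by metis
qed

section \<open>Structure and size of cliques\<close>

text \<open>If \<open>f\<close> separates \<open>a\<close> and \<open>b\<close>, then
  \<open>g a = g b\<close>; every further element differs from \<open>a\<close> or from
  \<open>b\<close> under \<open>f\<close>, hence shares this value of \<open>g\<close>.\<close>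

lemma constant_on_or_constant_on:
  assumes "\<And>x y. x \<in> S \<Longrightarrow> y \<in> S \<Longrightarrow> f x = f y \<or> g x = g y"
  shows "(\<forall>x\<in>S. \<forall>y\<in>S. f x = f y) \<or> (\<forall>x\<in>S. \<forall>y\<in>S. g x = g y)"
  using assms by metis

lemma rank_one_family:
  fixes C :: "('a::field^'n^'m) set"
  assumes "0 \<in> C" and clique: "\<And>X Y. X \<in> C \<Longrightarrow> Y \<in> C \<Longrightarrow> X \<noteq> Y \<Longrightarrow> rank (X - Y) = 1"
  shows "(\<exists>u. C \<subseteq> range (outer u)) \<or> (\<exists>v. C \<subseteq> range (\<lambda>u. outer u v))"
proof (cases "C = {0}")
  case True
  have "0 = outer u (0 :: 'a^'n)" for u :: "'a^'m"
    by (simp add: outer_eq_0_iff)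
  with True show ?thesis
    by blast
next
  case False
  define S where "S = C - {0}"
  obtain Z where Z: "Z \<in> S"
    using False assms(1) by (auto simp: S_def)
  have "\<exists>u v. u \<noteq> 0 \<and> v \<noteq> 0 \<and> X = outer u v" if "X \<in> S" for X
  proof -
    \<comment> \<open>Adjacency to \<open>0\<close> makes \<open>X\<close> itself an outer
      product.\<close>
    have "rank X = 1"
      using clique[of X 0] that assms(1) by (simp add: S_def)
    then show ?thesis
      by (metis rank_one_imp_outer)
  qed
  then obtain f g where nz: "\<And>X. X \<in> S \<Longrightarrow> f X \<noteq> 0 \<and> g X \<noteq> 0"
    and fg: "\<And>X. X \<in> S \<Longrightarrow> X = outer (f X) (g X)"
    by metis
  have "vec.span {f X} = vec.span {f Y} \<or> vec.span {g X} = vec.span {g Y}"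
    if "X \<in> S" "Y \<in> S" for X Y
  proof (cases "X = Y")
    case False
    then have "rank (X - Y) = 1"
      using clique[of X Y] \<open>X \<in> S\<close> \<open>Y \<in> S\<close> by (simp add: S_def)
    then obtain p r where "X - Y = outer p r"
      by (rule rank_one_imp_outer)
    then have "outer (f X) (g X) - outer (f Y) (g Y) = outer p r"
      using fg[OF \<open>X \<in> S\<close>] fg[OF \<open>Y \<in> S\<close>] by simp
    then show ?thesis
      by (rule outer_diff_eq_outer[rotated -1]) (simp_all add: nz \<open>X \<in> S\<close> \<open>Y \<in> S\<close>)
  qed simp
  then have "(\<forall>X\<in>S. \<forall>Y\<in>S. vec.span {f X} = vec.span {f Y}) \<or>
      (\<forall>X\<in>S. \<forall>Y\<in>S. vec.span {g X} = vec.span {g Y})"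
    by (rule constant_on_or_constant_on)
  then show ?thesis
  proof
    assume same: "\<forall>X\<in>S. \<forall>Y\<in>S. vec.span {f X} = vec.span {f Y}"
    have "X \<in> range (outer (f Z))" if "X \<in> C" for X
    proof (cases "X = 0")
      case True
      then have "X = outer (f Z) 0"
        by (simp add: outer_eq_0_iff)
      then show ?thesis
        by blast
    next
      case False
      with that have "X \<in> S"
        by (simp add: S_def)
      then have "f X \<in> vec.span {f Z}"
        using same Z vec.span_base[of "f X" "{f X}"] by blast
      then obtain c where "f X = c *s f Z"
        by (auto simp: vec.span_singleton)
      \<comment> \<open>The scalar between the column factors is absorbed into the row factor, so
        the column factor is exactly \<open>f Z\<close>.\<close>
      then have "X = outer (f Z) (c *s g X)"
        using fg[OF \<open>X \<in> S\<close>] by (simp add: outer_scale_left)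
      then show ?thesis
        by blast
    qed
    then show ?thesis
      by blast
  next
    assume same: "\<forall>X\<in>S. \<forall>Y\<in>S. vec.span {g X} = vec.span {g Y}"
    have "X \<in> range (\<lambda>u. outer u (g Z))" if "X \<in> C" for X
    proof (cases "X = 0")
      case True
      then have "X = outer 0 (g Z)"
        by (simp add: outer_eq_0_iff)
      then show ?thesis
        by blast
    next
      case False
      with that have "X \<in> S"
        by (simp add: S_def)
      then have "g X \<in> vec.span {g Z}"
        using same Z vec.span_base[of "g X" "{g X}"] by blast
      then obtain c where "g X = c *s g Z"
        by (auto simp: vec.span_singleton)
      then have "X = outer (c *s f X) (g Z)"
        using fg[OF \<open>X \<in> S\<close>] by (simp add: outer_scale_left)
      then show ?thesis
        by blast
    qed
    then show ?thesis
      by blast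
  qed
qed

text \<open>Translation preserves differences, so some member may be moved to \<open>0\<close>. The
  maximum reflects that either factor may be the fixed one; the two bounds coincide for square
  matrices.\<close>

lemma card_rank_one_clique_le:
  fixes C :: "('a::{field,finite}^'n^'m) set"
  assumes clique: "\<And>X Y. X \<in> C \<Longrightarrow> Y \<in> C \<Longrightarrow> X \<noteq> Y \<Longrightarrow> rank (X - Y) = 1"
  shows "card C \<le> max (CARD('a) ^ CARD('m)) (CARD('a) ^ CARD('n))"
proof (cases "C = {}")
  case False
  then obtain Z where "Z \<in> C"
    by blast
  define D where "D = (\<lambda>X. X - Z) ` C"
  have "card C = card D"
    unfolding D_def by (rule card_image[symmetric]) (simp add: inj_on_def)
  moreover have "(\<exists>u. D \<subseteq> range (outer u)) \<or> (\<exists>v. D \<subseteq> range (\<lambda>u. outer u v))"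
    by (rule rank_one_family) (use \<open>Z \<in> C\<close> clique in \<open>auto simp: D_def image_iff\<close>)
  then have "card D \<le> CARD('a^'n) \<or> card D \<le> CARD('a^'m)"
    using surj_card_le[of "UNIV :: ('a^'n) set" D] surj_card_le[of "UNIV :: ('a^'m) set" D]
    by fastforce
  ultimately show ?thesis
    by auto
qed simp

section \<open>From vertex sets to the clique number\<close>

text \<open>This replaces complete subgraphs by sets of pairwise adjacent vertices: \<open>C\<close>
  attains the value \<open>n\<close> and \<open>le\<close> bounds all such sets.\<close>

lemma clique_number_with_proj:
  assumes G: "graph (with_proj G)"
    and C: "C \<subseteq> pverts G" "card C = n"
      "\<And>x y. x \<in> C \<Longrightarrow> y \<in> C \<Longrightarrow> x \<noteq> y \<Longrightarrow> (x, y) \<in> parcs G"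
    and le: "\<And>C. C \<subseteq> pverts G \<Longrightarrow> (\<And>x y. x \<in> C \<Longrightarrow> y \<in> C \<Longrightarrow> x \<noteq> y \<Longrightarrow> (x, y) \<in> parcs G) \<Longrightarrow>
      card C \<le> n"
  shows "clique_number (with_proj G) = n"
  unfolding clique_number_def
proof (rule Max_eqI)
  interpret graph "with_proj G" by (rule G)
  show "finite {card (verts H) | H. subgraph H (with_proj G) \<and> K\<^bsub>card (verts H)\<^esub> H}"
    by (rule finite_clique_cards) (rule finite_verts)
  \<comment> \<open>Both orientations of every pair, without loops, make \<open>C\<close> a complete
    digraph.\<close>
  define H where "H = \<lparr>pverts = C, parcs = {(x, y). (x, y) \<in> C \<times> C \<and> x \<noteq> y}\<rparr>"
  have "finite C"
    using C(1) finite_verts by (auto intro: finite_subset)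
  then have "K\<^bsub>n\<^esub> (with_proj H)"
    using C(2) by (simp add: complete_digraph_pair_def H_def)
  moreover from this interpret H: graph "with_proj H"
    by (simp add: complete_digraph_def)
  have "subgraph (with_proj H) (with_proj G)"
    using C wf_digraph H.wf_digraph by (auto simp: subgraph_def compatible_def H_def)
  moreover have "card (verts (with_proj H)) = n"
    using C(2) by (simp add: H_def)
  ultimately show "n \<in> {card (verts H) | H. subgraph H (with_proj G) \<and> K\<^bsub>card (verts H)\<^esub> H}"
    by (metis (mono_tags, lifting) mem_Collect_eq)
next
  fix k assume "k \<in> {card (verts H) | H. subgraph H (with_proj G) \<and> K\<^bsub>card (verts H)\<^esub> H}"
  then obtain H where k: "k = card (verts H)" and sub: "subgraph H (with_proj G)"
    and complete: "K\<^bsub>card (verts H)\<^esub> H"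
    by blast
  show "k \<le> n"
    unfolding k
  proof (rule le)
    show "verts H \<subseteq> pverts G"
      using sub by (simp add: subgraph_def)
    fix x y assume "x \<in> verts H" "y \<in> verts H" "x \<noteq> y"
    then have "(x, y) \<in> arcs_ends H"
      using complete by (simp add: complete_digraph_def)
    then show "(x, y) \<in> parcs G"
      using sub by (auto simp: arcs_ends_conv subgraph_def compatible_def)
  qed
qed

theorem theorem3p18:
  assumes "CARD('n::finite) > 1"
  shows "clique_number (with_proj (rank_one_graph :: ('a::{field,finite}^'n^'n) pair_pre_digraph))
    = CARD('a) ^ CARD('n)"
proof (rule clique_number_with_proj[OF graph_rank_one_graph])
  \<comment> \<open>The all-ones vector serves as a concrete nonzero column factor.\<close>
  define e :: "'a^'n" where "e = 1"
  have "e \<noteq> 0"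
    by (simp add: e_def)
  then show "card (range (outer e) :: ('a^'n^'n) set) = CARD('a) ^ CARD('n)"
    by (simp add: card_image inj_outer)
  show "range (outer e) \<subseteq> pverts rank_one_graph"
    by (simp add: rank_one_graph_def)
  fix X Y :: "'a^'n^'n"
  assume "X \<in> range (outer e)" "Y \<in> range (outer e)" "X \<noteq> Y"
  then obtain v w where "X = outer e v" "Y = outer e w" "v - w \<noteq> 0"
    by auto
  then show "(X, Y) \<in> parcs rank_one_graph"
    using \<open>e \<noteq> 0\<close> by (simp add: rank_one_graph_def rank_outer flip: outer_diff_right)
next
  fix C :: "('a^'n^'n) set"
  assume "\<And>X Y. X \<in> C \<Longrightarrow> Y \<in> C \<Longrightarrow> X \<noteq> Y \<Longrightarrow> (X, Y) \<in> parcs rank_one_graph"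
  then show "card C \<le> CARD('a) ^ CARD('n)"
    using card_rank_one_clique_le[of C] by (simp add: rank_one_graph_def)
qed

end
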